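(* Let $m,n\ge 1$ be integers and let $A=[A_{i,j}]_{i,j=1}^m\in \mathbb{M}_m(\mathbb{M}_n)$ be positive semidefinite. Then \[ (\mathrm{tr}\,A)I_{mn}+(\mathrm{tr}_2 A)\otimes I_n\ \ge\ A+I_m\otimes(\mathrm{tr}_1 A)+2(\mathrm{tr}_2 D_A)\otimes I_n-2D_A, \] where $D_A=A_{1,1}\oplus A_{2,2}\oplus\cdots\oplus A_{m,m}$.
   Context: $\mathbb{M}_n$ is the space of $n\times n$ complex matrices. $\mathbb{M}_m(\mathbb{M}_n)$ is the set of $m\times m$ block matrices $A=[A_{i,j}]_{i,j=1}^m$ with blocks $A_{i,j}\in\mathbb{M}_n$, regarded also as $mn\times mn$ complex matrices. For Hermitian $X,Y$ of the same size, $X\ge Y$ means $X-Y$ is positive semidefinite. $\mathrm{tr}$ is the usual trace. The partial traces are $\mathrm{tr}_1 A=\sum_{i=1}^m A_{i,i}\in\mathbb{M}_n$ and $\mathrm{tr}_2 A=[\mathrm{tr}\,A_{i,j}]_{i,j=1}^m\in\mathbb{M}_m$. $\otimes$ is the Kronecker product: for $X=[x_{i,j}]\in\mathbb{M}_m$ and $Y\in\mathbb{M}_n$, $X\otimes Y\in\mathbb{M}_m(\mathbb{M}_n)$ has $(i,j)$ block $x_{i,j}Y$. $\oplus$ is the block-diagonal direct sum; $D_A$ is regarded as an element of $\mathbb{M}_m(\mathbb{M}_n)$. *)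

theory Defs
  imports "HOL-Analysis.Analysis"
begin

text \<open>
  The index types \<open>'m\<close> and \<open>'n\<close> stand for the index sets \<open>{1..m}\<close> and \<open>{1..n}\<close>. An
  \<open>m \<times> m\<close> block matrix with \<open>n \<times> n\<close> blocks is a matrix indexed by \<open>'m \<times> 'n\<close>:
  its entry at \<open>((i, p), (j, q))\<close> is the \<open>(p, q)\<close> entry of its \<open>(i, j)\<close> block.
\<close>

type_synonym 'n sqmat = "complex ^ 'n ^ 'n"
type_synonym ('m, 'n) block_mat = "('m \<times> 'n) sqmat"

definition smult_mat :: "complex \<Rightarrow> 'k::finite sqmat \<Rightarrow> 'k sqmat" (infixr "*\<^sub>M" 75) where
  "c *\<^sub>M X = (\<chi> i j. c * X $ i $ j)"

definition blk :: "('m::finite, 'n::finite) block_mat \<Rightarrow> 'm \<Rightarrow> 'm \<Rightarrow> 'n sqmat" where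
  "blk A i j = (\<chi> p q. A $ (i, p) $ (j, q))"

definition of_blks :: "('m::finite \<Rightarrow> 'm \<Rightarrow> 'n::finite sqmat) \<Rightarrow> ('m, 'n) block_mat" where
  "of_blks B = (\<chi> a b. B (fst a) (fst b) $ snd a $ snd b)"

definition partial_trace1 :: "('m::finite, 'n::finite) block_mat \<Rightarrow> 'n sqmat" where
  "partial_trace1 A = (\<Sum>i\<in>UNIV. blk A i i)"

definition partial_trace2 :: "('m::finite, 'n::finite) block_mat \<Rightarrow> 'm sqmat" where
  "partial_trace2 A = (\<chi> i j. trace (blk A i j))"

definition kronecker :: "'m::finite sqmat \<Rightarrow> 'n::finite sqmat \<Rightarrow> ('m, 'n) block_mat"
    (infixr "\<otimes>\<^sub>K" 75) where
  "X \<otimes>\<^sub>K Y = of_blks (\<lambda>i j. (X $ i $ j) *\<^sub>M Y)"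

definition direct_sum :: "('m::finite \<Rightarrow> 'n::finite sqmat) \<Rightarrow> ('m, 'n) block_mat" where
  "direct_sum B = of_blks (\<lambda>i j. if i = j then B i else 0)"

definition block_diagonal :: "('m::finite, 'n::finite) block_mat \<Rightarrow> ('m, 'n) block_mat" where
  "block_diagonal A = direct_sum (\<lambda>i. blk A i i)"

definition hermitian :: "'k::finite sqmat \<Rightarrow> bool" where
  "hermitian X \<longleftrightarrow> (\<chi> i j. cnj (X $ j $ i)) = X"

definition pos_semidef :: "'k::finite sqmat \<Rightarrow> bool" where
  "pos_semidef X \<longleftrightarrow> hermitian X \<and>
     (\<forall>v :: complex ^ 'k. (\<Sum>i\<in>UNIV. cnj (v $ i) * (X *v v) $ i) \<in> \<real>\<^sub>\<ge>\<^sub>0)"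

text \<open>
  The Loewner order is a relation between Hermitian matrices, so both sides are required to be
  Hermitian; this does not follow from positive semidefiniteness of the difference.
\<close>

definition loewner_ge :: "'k::finite sqmat \<Rightarrow> 'k sqmat \<Rightarrow> bool" (infix "\<ge>\<^sub>L" 50) where
  "X \<ge>\<^sub>L Y \<longleftrightarrow> hermitian X \<and> hermitian Y \<and> pos_semidef (X - Y)"

end

theory Submission
  imports Defs
begin

text \<open>
  Write \<open>\<phi> X = (trace X) I - X\<close> for the reduction map. The difference \<open>D\<close> of the two sides has
  the blocks \<open>D\<^sub>i\<^sub>j = \<phi> A\<^sub>i\<^sub>j\<close> for \<open>i \<noteq> j\<close>, while \<open>D\<^sub>i\<^sub>i\<close> is the sum of \<open>\<phi> A\<^sub>k\<^sub>k\<close> over \<open>k \<noteq> i\<close>.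
  So the quadratic form of \<open>D\<close> at \<open>x\<close>, with block components \<open>x\<^sub>i\<close>, is the sum over all ordered
  pairs \<open>i \<noteq> j\<close> of \<open>x\<^sub>j\<^sup>* \<phi>(A\<^sub>i\<^sub>i) x\<^sub>j + x\<^sub>i\<^sup>* \<phi>(A\<^sub>i\<^sub>j) x\<^sub>j\<close>.

  If \<open>A\<close> has rank one, \<open>A\<^sub>i\<^sub>j = a\<^sub>i a\<^sub>j\<^sup>*\<close>, Lagrange's identity turns the two terms into
  inner products of bivectors: they are \<open>\<parallel>a\<^sub>i \<and> x\<^sub>j\<parallel>\<^sup>2\<close> and \<open>\<langle>a\<^sub>j \<and> x\<^sub>i, a\<^sub>i \<and> x\<^sub>j\<rangle>\<close>. The ordered
  pairs \<open>(i, j)\<close> and \<open>(j, i)\<close> together therefore contribute \<open>\<parallel>a\<^sub>i \<and> x\<^sub>j + a\<^sub>j \<and> x\<^sub>i\<parallel>\<^sup>2 \<ge> 0\<close>.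

  For general \<open>A\<close> the same identity is used in a form linear in \<open>A\<close>: the \<open>(p, q)\<close> coordinate of
  \<open>a\<^sub>i \<and> x\<^sub>j + a\<^sub>j \<and> x\<^sub>i\<close> is linear in \<open>a\<close>, so its squared modulus is the quadratic form of \<open>A\<close> at a
  vector supported on four indices (\<open>wedge_vector\<close>), and in this form the identity holds for
  every matrix \<open>A\<close> (\<open>sesq_wedge_vector\<close> and \<open>four_times_sesq_offdiag\<close>).
\<close>

section \<open>Sesquilinear forms\<close>

definition sesq :: "complex ^ 'k::finite \<Rightarrow> 'k sqmat \<Rightarrow> complex ^ 'k \<Rightarrow> complex" where
  "sesq u X w = (\<Sum>i\<in>UNIV. \<Sum>j\<in>UNIV. cnj (u $ i) * X $ i $ j * w $ j)"

lemma pos_semidef_iff_sesq: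
  "pos_semidef X \<longleftrightarrow> hermitian X \<and> (\<forall>v. sesq v X v \<in> \<real>\<^sub>\<ge>\<^sub>0)"
  by (simp add: pos_semidef_def sesq_def matrix_vector_mult_def sum_distrib_left mult.assoc)

lemma sesq_add_left: "sesq (u + v) X w = sesq u X w + sesq v X w"
  by (simp add: sesq_def algebra_simps sum.distrib)

lemma sesq_add_right: "sesq w X (u + v) = sesq w X u + sesq w X v"
  by (simp add: sesq_def algebra_simps sum.distrib)

lemma sesq_sum_mat: "sesq u (sum F K) w = (\<Sum>k\<in>K. sesq u (F k) w)"
proof -
  have "sesq u (0 :: 'a sqmat) w = 0" and
    "\<And>X Y. sesq u (X + Y) w = sesq u X w + sesq u Y w" for u w :: "complex ^ 'a"
    by (simp_all add: sesq_def algebra_simps sum.distrib)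
  then show ?thesis
    by (induction K rule: infinite_finite_induct) simp_all
qed

lemma sesq_axis: "sesq (axis a s) X (axis b t) = cnj s * X $ a $ b * t"
proof -
  have "cnj (axis a s $ i) * X $ i $ j * axis b t $ j =
      (if j = b then if i = a then cnj s * X $ a $ b * t else 0 else 0)" for i j
    by (simp add: axis_def)
  then show ?thesis
    by (simp add: sesq_def)
qed

definition block_vec :: "complex ^ ('m::finite \<times> 'n::finite) \<Rightarrow> 'm \<Rightarrow> complex ^ 'n" where
  "block_vec x i = (\<chi> p. x $ (i, p))"

lemma sum_UNIV_prod:
  "(\<Sum>a\<in>UNIV. f a) = (\<Sum>i\<in>UNIV. \<Sum>p\<in>UNIV. f (i :: 'a::finite, p :: 'b::finite))"
  by (simp add: sum.cartesian_product UNIV_Times_UNIV[symmetric] del: UNIV_Times_UNIV)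

lemma sesq_blocks:
  "sesq x X y = (\<Sum>i\<in>UNIV. \<Sum>j\<in>UNIV. sesq (block_vec x i) (blk X i j) (block_vec y j))"
  unfolding sesq_def sum_UNIV_prod block_vec_def blk_def
  by (intro sum.cong refl) (simp, rule sum.swap)

section \<open>Hermitian matrices\<close>

lemma hermitian_iff: "hermitian X \<longleftrightarrow> (\<forall>i j. cnj (X $ j $ i) = X $ i $ j)"
  by (simp add: hermitian_def vec_eq_iff)

lemma hermitian_add: "hermitian X \<Longrightarrow> hermitian Y \<Longrightarrow> hermitian (X + Y)"
  by (simp add: hermitian_iff)

lemma hermitian_diff: "hermitian X \<Longrightarrow> hermitian Y \<Longrightarrow> hermitian (X - Y)"
  by (simp add: hermitian_iff)

lemma hermitian_smult: "cnj c = c \<Longrightarrow> hermitian X \<Longrightarrow> hermitian (c *\<^sub>M X)"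
  by (simp add: hermitian_iff smult_mat_def)

lemma hermitian_mat_1: "hermitian (mat 1)"
  by (auto simp: hermitian_iff mat_def)

lemma hermitian_trace_real: "hermitian X \<Longrightarrow> cnj (trace X) = trace X"
  by (simp add: hermitian_iff trace_def)

lemma hermitian_partial_trace1: "hermitian A \<Longrightarrow> hermitian (partial_trace1 A)"
  by (simp add: hermitian_iff partial_trace1_def blk_def)

lemma hermitian_partial_trace2: "hermitian A \<Longrightarrow> hermitian (partial_trace2 A)"
  by (simp add: hermitian_iff partial_trace2_def blk_def trace_def)

lemma hermitian_block_diagonal: "hermitian A \<Longrightarrow> hermitian (block_diagonal A)"
  by (auto simp: hermitian_iff block_diagonal_def direct_sum_def of_blks_def blk_def)

lemma hermitian_kronecker: "hermitian X \<Longrightarrow> hermitian Y \<Longrightarrow> hermitian (X \<otimes>\<^sub>K Y)"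
  by (simp add: hermitian_iff kronecker_def of_blks_def smult_mat_def)

section \<open>The reduction map and the blocks of the difference\<close>

definition reduction :: "'k::finite sqmat \<Rightarrow> 'k sqmat" where
  "reduction X = trace X *\<^sub>M mat 1 - X"

lemma sesq_reduction:
  "sesq u (reduction X) w =
    (\<Sum>p\<in>UNIV. \<Sum>q\<in>UNIV. cnj (u $ q) * w $ q * X $ p $ p - cnj (u $ p) * X $ p $ q * w $ q)"
proof -
  have "(\<Sum>p\<in>UNIV. \<Sum>q\<in>UNIV. cnj (u $ p) * (trace X * mat 1 $ p $ q) * w $ q) =
      (\<Sum>p\<in>UNIV. cnj (u $ p) * trace X * w $ p)"
    by (simp add: mat_def if_distrib[of "\<lambda>z. _ * z"] if_distrib[of "\<lambda>z. z * _"] cong: if_cong)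
  also have "\<dots> = (\<Sum>p\<in>UNIV. \<Sum>q\<in>UNIV. cnj (u $ q) * w $ q * X $ p $ p)"
    by (subst sum.swap) (simp add: trace_def sum_distrib_left sum_distrib_right mult_ac)
  finally show ?thesis
    by (simp add: sesq_def reduction_def smult_mat_def algebra_simps sum_subtractf)
qed

definition offdiag_reduction :: "('m::finite, 'n::finite) block_mat \<Rightarrow> ('m, 'n) block_mat" where
  "offdiag_reduction A = of_blks (\<lambda>i j.
    if i = j then \<Sum>k\<in>-{i}. reduction (blk A k k) else reduction (blk A i j))"

text \<open>
  In the \<open>i\<close>-th diagonal block, \<open>(tr\<^sub>2 A) \<otimes> I - A\<close> contributes \<open>\<phi> A\<^sub>i\<^sub>i\<close> and the last two terms
  of the right-hand side, subtracted, add \<open>- 2 \<phi> A\<^sub>i\<^sub>i\<close>. The remaining terms give \<open>\<phi>\<close> of the sum of all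
  \<open>A\<^sub>k\<^sub>k\<close>, from which exactly the summand \<open>k = i\<close> is thereby removed.
\<close>

lemma difference_eq_offdiag_reduction:
  fixes A :: "('m::finite, 'n::finite) block_mat"
  shows "trace A *\<^sub>M mat 1 + partial_trace2 A \<otimes>\<^sub>K mat 1
    - (A + mat 1 \<otimes>\<^sub>K partial_trace1 A
        + 2 *\<^sub>M (partial_trace2 (block_diagonal A) \<otimes>\<^sub>K mat 1) - 2 *\<^sub>M block_diagonal A)
    = offdiag_reduction A" (is "?L = _")
proof -
  have "?L $ (i, p) $ (j, q) = offdiag_reduction A $ (i, p) $ (j, q)" for i j p q
  proof (cases "i = j")
    case False
    then show ?thesis
      by (simp add: offdiag_reduction_def of_blks_def kronecker_def smult_mat_def mat_def
          block_diagonal_def direct_sum_def partial_trace2_def blk_def reduction_def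
          trace_def)
  next
    case True
    have tr: "trace A = trace (blk A i i) + (\<Sum>k\<in>-{i}. trace (blk A k k))"
      by (simp add: trace_def sum_UNIV_prod blk_def sum.remove[of UNIV i] Compl_eq_Diff_UNIV)
    have pt: "(\<Sum>k\<in>UNIV. A $ (k, p) $ (k, q)) =
        A $ (i, p) $ (i, q) + (\<Sum>k\<in>-{i}. A $ (k, p) $ (k, q))" for p q
      by (simp add: sum.remove[of UNIV i] Compl_eq_Diff_UNIV)
    have pt2: "trace (blk (block_diagonal A) i i) = trace (blk A i i)"
      by (simp add: trace_def blk_def block_diagonal_def direct_sum_def of_blks_def)
    have "offdiag_reduction A $ (i, p) $ (i, q) =
        (\<Sum>k\<in>-{i}. (if p = q then trace (blk A k k) else 0) - A $ (k, p) $ (k, q))"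
      by (simp add: offdiag_reduction_def of_blks_def reduction_def smult_mat_def mat_def blk_def)
    also have "\<dots> = (if p = q then \<Sum>k\<in>-{i}. trace (blk A k k) else 0)
        - (\<Sum>k\<in>-{i}. A $ (k, p) $ (k, q))"
      by (simp add: sum_subtractf)
    also have "\<dots> = ?L $ (i, p) $ (i, q)"
      by (simp add: tr pt pt2 kronecker_def of_blks_def smult_mat_def mat_def
          partial_trace1_def partial_trace2_def)
        (simp add: blk_def pt block_diagonal_def direct_sum_def of_blks_def)
    finally show ?thesis
      using True by simp
  qed
  then show ?thesis
    by (auto simp: vec_eq_iff)
qed

section \<open>The quadratic form as a sum of squares\<close>

text \<open>
  For \<open>A = a a\<^sup>*\<close> the quadratic form of \<open>A\<close> at this vector is the squared modulus of the \<open>(p, q)\<close>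
  coordinate \<open>a\<^sub>i\<^sub>p x\<^sub>j\<^sub>q - a\<^sub>i\<^sub>q x\<^sub>j\<^sub>p + a\<^sub>j\<^sub>p x\<^sub>i\<^sub>q - a\<^sub>j\<^sub>q x\<^sub>i\<^sub>p\<close> of \<open>a\<^sub>i \<and> x\<^sub>j + a\<^sub>j \<and> x\<^sub>i\<close>.
\<close>

definition wedge_vector ::
    "complex ^ ('m::finite \<times> 'n::finite) \<Rightarrow> 'm \<Rightarrow> 'm \<Rightarrow> 'n \<Rightarrow> 'n \<Rightarrow> complex ^ ('m \<times> 'n)" where
  "wedge_vector x i j p q =
    axis (i, p) (cnj (x $ (j, q))) + axis (i, q) (- cnj (x $ (j, p)))
    + axis (j, p) (cnj (x $ (i, q))) + axis (j, q) (- cnj (x $ (i, p)))"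

text \<open>
  The part of the quadratic form at \<open>wedge_vector x i j p q\<close> in which the row index is \<open>(i, p)\<close>.
  Summed over \<open>p\<close> and \<open>q\<close>, its first two terms give \<open>x\<^sub>j\<^sup>* \<phi>(A\<^sub>i\<^sub>i) x\<^sub>j\<close> and its last two
  \<open>x\<^sub>i\<^sup>* \<phi>(A\<^sub>i\<^sub>j) x\<^sub>j\<close>.
\<close>

definition wedge_term ::
    "('m::finite, 'n::finite) block_mat \<Rightarrow> complex ^ ('m \<times> 'n) \<Rightarrow> 'm \<Rightarrow> 'm \<Rightarrow> 'n \<Rightarrow> 'n \<Rightarrow> complex" where
  "wedge_term A x i j p q = x $ (j, q) *
    (cnj (x $ (j, q)) * A $ (i, p) $ (i, p) - cnj (x $ (j, p)) * A $ (i, p) $ (i, q)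
     + cnj (x $ (i, q)) * A $ (i, p) $ (j, p) - cnj (x $ (i, p)) * A $ (i, p) $ (j, q))"

lemma sum_wedge_term:
  "(\<Sum>p\<in>UNIV. \<Sum>q\<in>UNIV. wedge_term A x i j p q) =
    sesq (block_vec x j) (reduction (blk A i i)) (block_vec x j)
    + sesq (block_vec x i) (reduction (blk A i j)) (block_vec x j)"
  unfolding sesq_reduction sum.distrib[symmetric]
  by (intro sum.cong refl) (simp add: wedge_term_def block_vec_def blk_def algebra_simps)

text \<open>
  Exchanging \<open>i\<close> with \<open>j\<close> preserves \<open>wedge_vector x i j p q\<close> and exchanging \<open>p\<close> with \<open>q\<close> negates
  it. These exchanges permute its four entries transitively, so the four groups of terms of the
  quadratic form, one for each row index, are copies of a single one.
\<close>

lemma sesq_wedge_vector: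
  "sesq (wedge_vector x i j p q) A (wedge_vector x i j p q) =
    wedge_term A x i j p q + wedge_term A x j i p q
    + wedge_term A x i j q p + wedge_term A x j i q p"
  unfolding wedge_vector_def sesq_add_left sesq_add_right sesq_axis wedge_term_def
  by (simp add: algebra_simps)

lemma sesq_offdiag_reduction:
  "sesq x (offdiag_reduction A) x =
    (\<Sum>i\<in>UNIV. \<Sum>j\<in>-{i}. \<Sum>p\<in>UNIV. \<Sum>q\<in>UNIV. wedge_term A x i j p q)"
proof -
  let ?d = "\<lambda>i k. sesq (block_vec x i) (reduction (blk A k k)) (block_vec x i)"
  let ?o = "\<lambda>i j. sesq (block_vec x i) (reduction (blk A i j)) (block_vec x j)"
  have blk: "blk (offdiag_reduction A) i j =
      (if i = j then \<Sum>k\<in>-{i}. reduction (blk A k k) else reduction (blk A i j))" for i j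
    by (simp add: offdiag_reduction_def blk_def of_blks_def vec_eq_iff)
  have row: "(\<Sum>j\<in>UNIV. sesq (block_vec x i) (blk (offdiag_reduction A) i j) (block_vec x j)) =
      (\<Sum>k\<in>-{i}. ?d i k) + (\<Sum>j\<in>-{i}. ?o i j)" for i
  proof -
    have "(\<Sum>j\<in>UNIV. sesq (block_vec x i) (blk (offdiag_reduction A) i j) (block_vec x j)) =
        sesq (block_vec x i) (blk (offdiag_reduction A) i i) (block_vec x i)
        + (\<Sum>j\<in>-{i}. sesq (block_vec x i) (blk (offdiag_reduction A) i j) (block_vec x j))"
      by (simp add: sum.remove[of UNIV i] Compl_eq_Diff_UNIV)
    also have "(\<Sum>j\<in>-{i}. sesq (block_vec x i) (blk (offdiag_reduction A) i j) (block_vec x j)) =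
        (\<Sum>j\<in>-{i}. ?o i j)"
      by (intro sum.cong refl) (auto simp: blk)
    finally show ?thesis
      by (simp add: blk sesq_sum_mat)
  qed
  have "(\<Sum>i\<in>UNIV. \<Sum>k\<in>-{i}. ?d i k) = (\<Sum>k\<in>UNIV. \<Sum>i\<in>-{k}. ?d i k)"
    using sum.swap_restrict[of UNIV UNIV ?d "\<lambda>i k. k \<noteq> i"]
    by (simp add: Compl_eq Collect_neg_eq[symmetric] eq_commute)
  then show ?thesis
    by (simp add: sesq_blocks[of x "offdiag_reduction A"] row sum.distrib sum_wedge_term)
qed

text \<open>
  Summation over all \<open>i \<noteq> j\<close>, \<open>p\<close> and \<open>q\<close> identifies the four copies in \<open>sesq_wedge_vector\<close>. The
  factor is \<open>4\<close> because each unordered pair \<open>{i, j}\<close> and each unordered pair \<open>{p, q}\<close> occurs twice.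
\<close>

lemma four_times_sesq_offdiag:
  "4 * sesq x (offdiag_reduction A) x =
    (\<Sum>i\<in>UNIV. \<Sum>j\<in>-{i}. \<Sum>p\<in>UNIV. \<Sum>q\<in>UNIV.
      sesq (wedge_vector x i j p q) A (wedge_vector x i j p q))"
proof -
  let ?T = "wedge_term A x"
  have pq: "(\<Sum>p\<in>UNIV. \<Sum>q\<in>UNIV. ?T i j q p) = (\<Sum>p\<in>UNIV. \<Sum>q\<in>UNIV. ?T i j p q)" for i j
    by (rule sum.swap)
  have ij: "(\<Sum>i\<in>UNIV. \<Sum>j\<in>-{i}. f j i) = (\<Sum>i\<in>UNIV. \<Sum>j\<in>-{i}. f i j)"
    for f :: "'a \<Rightarrow> 'a \<Rightarrow> complex"
    using sum.swap_restrict[of UNIV UNIV "\<lambda>i j. f j i" "\<lambda>i j. j \<noteq> i"]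
    by (simp add: Compl_eq Collect_neg_eq[symmetric] eq_commute)
  show ?thesis
    using ij[of "\<lambda>i j. \<Sum>p\<in>UNIV. \<Sum>q\<in>UNIV. ?T i j p q"]
    by (simp add: sesq_wedge_vector sum.distrib pq sesq_offdiag_reduction sum_distrib_left[symmetric])
qed

lemma sum_in_nonneg_Reals:
  "(\<And>i. i \<in> I \<Longrightarrow> f i \<in> \<real>\<^sub>\<ge>\<^sub>0) \<Longrightarrow> sum f I \<in> \<real>\<^sub>\<ge>\<^sub>0"
  by (induction I rule: infinite_finite_induct) auto

lemma sesq_offdiag_reduction_nonneg:
  assumes "pos_semidef A"
  shows "sesq x (offdiag_reduction A) x \<in> \<real>\<^sub>\<ge>\<^sub>0"
proof -
  have "4 * sesq x (offdiag_reduction A) x \<in> \<real>\<^sub>\<ge>\<^sub>0"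
    unfolding four_times_sesq_offdiag
    using assms by (intro sum_in_nonneg_Reals) (simp add: pos_semidef_iff_sesq)
  then show ?thesis
    by (simp add: complex_nonneg_Reals_iff)
qed

theorem theorem4p1:
  fixes A :: "('m::finite, 'n::finite) block_mat"
  assumes "pos_semidef A"
  shows "trace A *\<^sub>M mat 1 + partial_trace2 A \<otimes>\<^sub>K mat 1
    \<ge>\<^sub>L A + mat 1 \<otimes>\<^sub>K partial_trace1 A
        + 2 *\<^sub>M (partial_trace2 (block_diagonal A) \<otimes>\<^sub>K mat 1) - 2 *\<^sub>M block_diagonal A"
    (is "?X \<ge>\<^sub>L ?Y")
proof -
  have A: "hermitian A"
    using assms by (simp add: pos_semidef_def)
  have X: "hermitian ?X"
    by (intro hermitian_add hermitian_smult hermitian_kronecker hermitian_partial_trace2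
        hermitian_mat_1 hermitian_trace_real A)
  have Y: "hermitian ?Y"
    by (intro hermitian_add hermitian_diff hermitian_smult hermitian_kronecker
        hermitian_partial_trace1 hermitian_partial_trace2 hermitian_block_diagonal
        hermitian_mat_1 A) simp_all
  have "pos_semidef (?X - ?Y)"
    using hermitian_diff[OF X Y] sesq_offdiag_reduction_nonneg[OF assms]
    by (simp only: pos_semidef_iff_sesq difference_eq_offdiag_reduction) simp
  with X Y show ?thesis
    by (simp add: loewner_ge_def)
qed

end
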